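(* Let $s\ge 1$ be a positive integer. Then for every $F\in A^2(\Pi^+)$, $$\int_{\Pi^+}|F(x+iy)|^{2s}y^{2s-2}\,dx\,dy\le \frac{\pi^{1-s}}{(2s-1)2^{2s-2}}\left(\int_{\Pi^+}|F(x+iy)|^2\, dx\,dy\right)^s.$$
   Context: $\Pi^+=\{x+iy\in\mathbb{C}: y>0\}$ is the upper half-plane. $A^2(\Pi^+)$ is the Bergman space of holomorphic functions $F$ on $\Pi^+$ with $\int_{\Pi^+}|F(x+iy)|^2\,dx\,dy<\infty$. *)

theory Defs
  imports "HOL-Analysis.Analysis"
begin

definition upper_half_plane :: "complex set" where
  "upper_half_plane = {z. Im z > 0}"

text \<open>
  The area measure \<open>dx dy\<close> is \<^const>\<open>lborel\<close> on \<^typ>\<open>complex\<close>, whose Euclidean basis is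
  \<open>{1, \<i>}\<close>.  Elements of the Bergman space are represented by total functions; their values
  off the upper half-plane are irrelevant.
\<close>

definition bergman_space :: "(complex \<Rightarrow> complex) set" where
  "bergman_space = {F. F holomorphic_on upper_half_plane \<and>
     (\<integral>\<^sup>+z\<in>upper_half_plane. ennreal ((cmod (F z))\<^sup>2) \<partial>lborel) < \<infinity>}"

end

theory Submission
  imports Defs "HOL-Complex_Analysis.Complex_Analysis"
begin

text \<open>
  Transplant the problem to the unit disc by the Cayley transform
  \<open>z = \<i> (1 + \<zeta>) / (1 - \<zeta>)\<close>.  With \<open>f \<zeta> = F z / (1 - \<zeta>)\<^sup>2\<close> all powers of \<open>\<bar>1 - \<zeta>\<bar>\<close> cancel, because
  \<open>Im z = (1 - \<bar>\<zeta>\<bar>\<^sup>2) / \<bar>1 - \<zeta>\<bar>\<^sup>2\<close> and \<open>\<bar>dz / d\<zeta>\<bar> = 2 / \<bar>1 - \<zeta>\<bar>\<^sup>2\<close>: the integral of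
  \<open>\<bar>F\<bar>\<^sup>2\<^sup>s y\<^sup>2\<^sup>s\<^sup>-\<^sup>2\<close> over the half-plane is four times the integral of
  \<open>\<bar>f\<^sup>s\<bar>\<^sup>2 (1 - \<bar>\<zeta>\<bar>\<^sup>2)\<^sup>2\<^sup>s\<^sup>-\<^sup>2\<close> over the disc.  The monomials are orthogonal for this radial weight, so the
  integral becomes a weighted square sum of the Taylor coefficients \<open>b\<^sub>n\<close> of \<open>f\<^sup>s\<close>:
  it equals \<open>4 \<pi> / (2 s - 1)\<close> times the sum of \<open>\<bar>b\<^sub>n\<bar>\<^sup>2 / ((n + 2 s - 1) choose n)\<close>
  (\<open>half_plane_integral_eq_coeff_sum\<close>).  For \<open>s = 1\<close> this is \<open>4 \<pi>\<close> times the sum of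
  \<open>\<bar>a\<^sub>n\<bar>\<^sup>2 / (n + 1)\<close>, with \<open>a\<^sub>n\<close> the coefficients of \<open>f\<close>.

  What remains is the discrete inequality \<open>fps_power_weighted_sum_le\<close>: the sum of
  \<open>\<bar>b\<^sub>n\<bar>\<^sup>2 / ((n + 2 s - 1) choose n)\<close> is at most the \<open>s\<close>-th power of the sum of
  \<open>\<bar>a\<^sub>n\<bar>\<^sup>2 / (n + 1)\<close>.  It follows from the Cauchy-Schwarz inequality applied to each convolution,
  since \<open>(n + k) choose n\<close> is the coefficient of \<open>x\<^sup>n\<close> in \<open>(1 - x)\<^sup>-\<^sup>(\<^sup>k\<^sup>+\<^sup>1\<^sup>)\<close>, so that the weights
  themselves convolve to weights.

  On the analytic side, polar coordinates in the disc are written as \<open>\<zeta> = exp (- w)\<close> with \<open>w\<close> in the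
  half-strip \<open>Re w > 0\<close>, \<open>- \<pi> \<le> Im w < \<pi>\<close>.  The map from the half-strip to the half-plane is then
  holomorphic and injective, and it misses only the point \<open>\<i>\<close>.  One change of variables, whose
  Jacobian is the squared modulus of the derivative
  (\<open>nn_integral_holomorphic_change_of_variables\<close>), thus leads to an iterated integral:
  Parseval's identity handles the variable \<open>Im w\<close>, and a Beta integral handles \<open>Re w\<close>.
\<close>

section \<open>Taylor coefficients of powers\<close>

text \<open>
  Comparison of coefficients in \<open>(1 - x)\<^sup>-\<^sup>(\<^sup>k\<^sup>+\<^sup>1\<^sup>) (1 - x)\<^sup>-\<^sup>2 = (1 - x)\<^sup>-\<^sup>(\<^sup>k\<^sup>+\<^sup>3\<^sup>)\<close>.  In the
  induction, raising \<open>n\<close> adds one hockey-stick sum to the left-hand side.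
\<close>

lemma sum_choose_convolution:
  "(\<Sum>i\<le>n. ((i + k) choose i) * (n - i + 1)) = (n + k + 2) choose n"
proof (induction n)
  case (Suc n)
  have "(\<Sum>i\<le>Suc n. ((i + k) choose i) * (Suc n - i + 1))
      = (\<Sum>i\<le>n. ((i + k) choose i) * (n - i + 1)) + (\<Sum>i\<le>Suc n. (i + k) choose i)"
    by (simp add: sum.distrib[symmetric] Suc_diff_le algebra_simps)
  also have "(\<Sum>i\<le>Suc n. (i + k) choose i) = (Suc n + k + 1) choose Suc n"
    using sum_choose_lower[of k "Suc n"] by (simp add: ac_simps)
  finally show ?case using Suc by simp
qed simp

text \<open>The triangle \<open>i + j < N\<close> lies inside the square \<open>i, j < N\<close>.\<close>

lemma sum_convolution_le_prod:
  fixes x y :: "nat \<Rightarrow> real"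
  assumes "\<And>n. x n \<ge> 0" "\<And>n. y n \<ge> 0"
  shows "(\<Sum>n<N. \<Sum>i\<le>n. x i * y (n - i)) \<le> (\<Sum>n<N. x n) * (\<Sum>n<N. y n)"
proof -
  have "(\<Sum>n<N. \<Sum>i\<le>n. x i * y (n - i)) = (\<Sum>(i,j)\<in>{(i,j). i + j < N}. x i * y j)"
    using sum.triangle_reindex[of "\<lambda>i j. x i * y j" N] by simp
  also have "\<dots> \<le> (\<Sum>(i,j)\<in>{..<N} \<times> {..<N}. x i * y j)"
    by (rule sum_mono2) (use assms in auto)
  also have "\<dots> = (\<Sum>n<N. x n) * (\<Sum>n<N. y n)"
    by (simp add: sum_product sum.cartesian_product)
  finally show ?thesis .
qed

text \<open>
  The Cauchy-Schwarz inequality with each summand divided and multiplied by the square root of the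
  weight \<open>((i + k) choose i) * (n - i + 1)\<close>; these weights add up to the binomial coefficient on
  the left-hand side.
\<close>

lemma norm_convolution_square_le:
  fixes b a :: "complex fps"
  shows "(cmod (fps_nth (b * a) n))\<^sup>2 / real ((n + k + 2) choose n)
     \<le> (\<Sum>i\<le>n. ((cmod (fps_nth b i))\<^sup>2 / real ((i + k) choose i)) * ((cmod (fps_nth a (n - i)))\<^sup>2 / (real (n - i) + 1)))"
proof -
  define w where "w i = real ((i + k) choose i)" for i
  define v where "v i = real (n - i) + 1" for i
  have pos: "w i > 0" "v i > 0" for i
    by (auto simp: w_def v_def)
  have "cmod (fps_nth (b * a) n) \<le> (\<Sum>i\<le>n. cmod (fps_nth b i) * cmod (fps_nth a (n - i)))"
    unfolding fps_mult_nth atLeast0AtMost by (rule order_trans[OF norm_sum]) (simp add: norm_mult)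
  also have "\<dots> = (\<Sum>i\<le>n. (cmod (fps_nth b i) / sqrt (w i) * (cmod (fps_nth a (n - i)) / sqrt (v i))) * (sqrt (w i) * sqrt (v i)))"
    using pos by (intro sum.cong) (auto simp: field_simps less_imp_neq[symmetric])
  finally have "(cmod (fps_nth (b * a) n))\<^sup>2 \<le> (\<dots>)\<^sup>2"
    by (rule power_mono) simp
  also have "\<dots> \<le> (\<Sum>i\<le>n. (cmod (fps_nth b i) / sqrt (w i) * (cmod (fps_nth a (n - i)) / sqrt (v i)))\<^sup>2) * (\<Sum>i\<le>n. (sqrt (w i) * sqrt (v i))\<^sup>2)"
    by (rule Cauchy_Schwarz_ineq_sum)
  also have "(\<Sum>i\<le>n. (sqrt (w i) * sqrt (v i))\<^sup>2) = (\<Sum>i\<le>n. w i * v i)"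
    using pos by (intro sum.cong) (auto simp: power_mult_distrib less_imp_le)
  also have "\<dots> = real ((n + k + 2) choose n)"
    unfolding sum_choose_convolution[symmetric] of_nat_sum w_def v_def by (intro sum.cong) (auto simp: distrib_left)
  also have "(\<Sum>i\<le>n. (cmod (fps_nth b i) / sqrt (w i) * (cmod (fps_nth a (n - i)) / sqrt (v i)))\<^sup>2) =
    (\<Sum>i\<le>n. ((cmod (fps_nth b i))\<^sup>2 / w i) * ((cmod (fps_nth a (n - i)))\<^sup>2 / v i))"
    using pos by (intro sum.cong) (auto simp: power_mult_distrib power_divide less_imp_le)
  finally show ?thesis
    by (simp add: w_def v_def field_simps)
qed

text \<open>
  The discrete form of the theorem, stated for truncated sums so that no convergence is involved.
  Each further factor \<open>a\<close> raises the index \<open>k\<close> of the weight \<open>(n + k) choose n\<close> by two.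
\<close>

lemma fps_power_weighted_sum_le:
  fixes a :: "complex fps"
  shows "(\<Sum>n<N. (cmod (fps_nth (a ^ Suc t) n))\<^sup>2 / real ((n + (2 * t + 1)) choose n))
    \<le> (\<Sum>n<N. (cmod (fps_nth a n))\<^sup>2 / (real n + 1)) ^ Suc t"
proof (induction t)
  case 0
  have "real ((n + 1) choose n) = real n + 1" for n
    by simp
  then show ?case by (simp add: add.commute)
next
  case (Suc t)
  let ?k = "2 * t + 1"
  let ?x = "\<lambda>i. (cmod (fps_nth (a ^ Suc t) i))\<^sup>2 / real ((i + ?k) choose i)"
  let ?y = "\<lambda>i. (cmod (fps_nth a i))\<^sup>2 / (real i + 1)"
  have "(\<Sum>n<N. (cmod (fps_nth (a ^ Suc (Suc t)) n))\<^sup>2 / real ((n + (2 * Suc t + 1)) choose n))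
      \<le> (\<Sum>n<N. \<Sum>i\<le>n. ?x i * ?y (n - i))"
  proof (rule sum_mono)
    fix n
    show "(cmod (fps_nth (a ^ Suc (Suc t)) n))\<^sup>2 / real ((n + (2 * Suc t + 1)) choose n) \<le> (\<Sum>i\<le>n. ?x i * ?y (n - i))"
      using norm_convolution_square_le[of "a ^ Suc t" a n ?k] by (simp only: power_Suc2) (simp add: ac_simps)
  qed
  also have "\<dots> \<le> (\<Sum>n<N. ?x n) * (\<Sum>n<N. ?y n)"
    by (rule sum_convolution_le_prod) auto
  also have "\<dots> \<le> (\<Sum>n<N. ?y n) ^ Suc t * (\<Sum>n<N. ?y n)"
    by (intro mult_right_mono Suc.IH sum_nonneg) auto
  finally show ?case by (simp only: power_Suc2)
qed

lemma fps_power_sums: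
  fixes a :: "complex fps"
  assumes f: "\<And>z. cmod z < 1 \<Longrightarrow> (\<lambda>n. fps_nth a n * z ^ n) sums f z"
    and z: "cmod z < 1"
  shows "(\<lambda>n. fps_nth (a ^ s) n * z ^ n) sums (f z ^ s)"
proof -
  have "\<forall>z. cmod z < 1 \<longrightarrow> (\<lambda>n. fps_nth (a ^ s) n * z ^ n) sums (f z ^ s)"
  proof (induction s)
    case 0
    have "(\<lambda>n. fps_nth (1 :: complex fps) n * z ^ n) sums 1" for z
      using sums_If_finite_set[of "{0}" "\<lambda>n. 1"] sums_single[of 0 "\<lambda>n. 1::complex"]
      by (auto simp: if_distrib if_distribR cong: if_cong)
    then show ?case by simp
  next
    case (Suc s)
    show ?case
    proof (intro allI impI)
      fix z :: complex assume z: "cmod z < 1"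
      \<comment> \<open>Convergence at a point of larger modulus gives absolute convergence at \<open>z\<close>.\<close>
      have abs: "summable (\<lambda>n. norm (fps_nth b n * z ^ n))" 
        if "\<And>z. cmod z < 1 \<Longrightarrow> summable (\<lambda>n. fps_nth b n * z ^ n)" for b :: "complex fps"
      proof -
        obtain r where r: "cmod z < r" "r < 1"
          using z dense by blast
        have r0: "r > 0" using r(1) norm_ge_zero[of z] by linarith
        show ?thesis
          by (rule powser_insidea[OF that[of "of_real r"]]) (use r r0 in auto)
      qed
      have "(\<lambda>n. \<Sum>i\<le>n. (fps_nth a i * z ^ i) * (fps_nth (a ^ s) (n - i) * z ^ (n - i)))
         sums ((\<Sum>n. fps_nth a n * z ^ n) * (\<Sum>n. fps_nth (a ^ s) n * z ^ n))"
        using f Suc.IH by (intro Cauchy_product_sums abs) (auto simp: sums_iff)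
      also have "(\<Sum>n. fps_nth a n * z ^ n) * (\<Sum>n. fps_nth (a ^ s) n * z ^ n) = f z ^ Suc s"
        using f[OF z] Suc.IH z by (simp add: sums_iff)
      also have "(\<lambda>n. \<Sum>i\<le>n. (fps_nth a i * z ^ i) * (fps_nth (a ^ s) (n - i) * z ^ (n - i)))
         = (\<lambda>n. fps_nth (a ^ Suc s) n * z ^ n)"
      proof
        fix n
        have "fps_nth a i * z ^ i * (fps_nth (a ^ s) (n - i) * z ^ (n - i)) 
            = fps_nth a i * fps_nth (a ^ s) (n - i) * z ^ n" if "i \<le> n" for i
          using that by (simp add: mult_ac flip: power_add)
        then have "(\<Sum>i\<le>n. fps_nth a i * z ^ i * (fps_nth (a ^ s) (n - i) * z ^ (n - i)))
            = (\<Sum>i\<le>n. fps_nth a i * fps_nth (a ^ s) (n - i) * z ^ n)"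
          by (intro sum.cong) auto
        then show "(\<Sum>i\<le>n. fps_nth a i * z ^ i * (fps_nth (a ^ s) (n - i) * z ^ (n - i)))
            = fps_nth (a ^ Suc s) n * z ^ n"
          by (simp add: fps_mult_nth sum_distrib_right atLeast0AtMost)
      qed
      finally show "(\<lambda>n. fps_nth (a ^ Suc s) n * z ^ n) sums (f z ^ Suc s)" .
    qed
  qed
  then show ?thesis using z by blast
qed

section \<open>Parseval's identity and radial moments\<close>

lemma has_integral_exp_period:
  fixes k :: int
  shows "((\<lambda>t. exp (\<i> * of_int k * of_real t)) has_integral (if k = 0 then 2 * complex_of_real pi else 0)) {- pi..pi}"
proof (cases "k = 0")
  case True
  then show ?thesis
    using has_integral_const_real[of "1::complex" "- pi" pi] by (simp add: scaleR_conv_of_real)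
next
  case False
  let ?c = "\<i> * of_int k :: complex"
  have c: "?c \<noteq> 0" using False by simp
  have "((\<lambda>t. exp (?c * of_real t) / ?c) has_vector_derivative exp (?c * of_real t)) (at t within {- pi..pi})" for t
  proof -
    have "((\<lambda>z. exp (?c * z) / ?c) has_field_derivative exp (?c * of_real t)) (at (of_real t))"
      using False by (auto intro!: derivative_eq_intros)
    then show ?thesis
      by (rule has_vector_derivative_real_field)
  qed
  then have "((\<lambda>t. exp (?c * of_real t)) has_integral (exp (?c * of_real pi) / ?c - exp (?c * of_real (- pi)) / ?c)) {- pi..pi}"
    by (intro fundamental_theorem_of_calculus) auto
  moreover have "exp (?c * of_real pi) = exp (?c * of_real (- pi))"
    unfolding exp_eq by (rule exI[of _ k]) (simp add: algebra_simps)
  ultimately show ?thesis using False by simp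
qed

lemma has_integral_norm_trig_poly_square:
  fixes c :: "nat \<Rightarrow> complex"
  shows "((\<lambda>t. (cmod (\<Sum>n<N. c n * exp (- (\<i> * of_nat n * of_real t))))\<^sup>2)
     has_integral 2 * pi * (\<Sum>n<N. (cmod (c n))\<^sup>2)) {- pi..pi}"
proof -
  let ?e = "\<lambda>n t. exp (- (\<i> * of_nat n * of_real t)) :: complex"
  have "((\<lambda>t. \<Sum>n<N. \<Sum>m<N. (c n * cnj (c m)) * exp (\<i> * of_int (int m - int n) * of_real t))
    has_integral (\<Sum>n<N. \<Sum>m<N. (c n * cnj (c m)) * (if int m - int n = 0 then 2 * complex_of_real pi else 0))) {- pi..pi}"
    by (intro has_integral_sum has_integral_mult_right has_integral_exp_period) auto
  also have "(\<lambda>t. \<Sum>n<N. \<Sum>m<N. (c n * cnj (c m)) * exp (\<i> * of_int (int m - int n) * of_real t))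
     = (\<lambda>t. of_real ((cmod (\<Sum>n<N. c n * ?e n t))\<^sup>2))"
  proof
    fix t
    have "of_real ((cmod (\<Sum>n<N. c n * ?e n t))\<^sup>2) = (\<Sum>n<N. c n * ?e n t) * cnj (\<Sum>m<N. c m * ?e m t)"
      by (rule complex_norm_square)
    also have "\<dots> = (\<Sum>n<N. \<Sum>m<N. (c n * ?e n t) * cnj (c m * ?e m t))"
      by (simp add: sum_product)
    also have "\<dots> = (\<Sum>n<N. \<Sum>m<N. (c n * cnj (c m)) * exp (\<i> * of_int (int m - int n) * of_real t))"
    proof (intro sum.cong refl)
      fix n m
      have "?e n t * cnj (?e m t) = exp (\<i> * of_int (int m - int n) * of_real t)"
        by (simp add: exp_cnj exp_add[symmetric] algebra_simps)
      then show "(c n * ?e n t) * cnj (c m * ?e m t) = (c n * cnj (c m)) * exp (\<i> * of_int (int m - int n) * of_real t)"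
        by (metis (no_types, lifting) complex_cnj_mult mult.assoc mult.left_commute)
    qed
    finally show "(\<Sum>n<N. \<Sum>m<N. (c n * cnj (c m)) * exp (\<i> * of_int (int m - int n) * of_real t))
       = of_real ((cmod (\<Sum>n<N. c n * ?e n t))\<^sup>2)" by simp
  qed
  also have "(\<Sum>n<N. \<Sum>m<N. (c n * cnj (c m)) * (if int m - int n = 0 then 2 * complex_of_real pi else 0))
     = of_real (2 * pi * (\<Sum>n<N. (cmod (c n))\<^sup>2))"
  proof -
    have "(\<Sum>m<N. (c n * cnj (c m)) * (if int m - int n = 0 then 2 * complex_of_real pi else 0))
       = of_real (2 * pi * (cmod (c n))\<^sup>2)" if "n < N" for n
      using that by (simp add: if_distrib sum.delta complex_norm_square mult_ac cong: if_cong del: of_real_power)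
    then show ?thesis
      by (simp add: sum_distrib_left del: of_real_power)
  qed
  finally have "((\<lambda>t. complex_of_real ((cmod (\<Sum>n<N. c n * ?e n t))\<^sup>2)) has_integral
      complex_of_real (2 * pi * (\<Sum>n<N. (cmod (c n))\<^sup>2))) {- pi..pi}" .
  from has_integral_linear[OF this bounded_linear_Re] show ?thesis
    by (simp add: o_def)
qed

text \<open>
  Absolute summability bounds all partial sums uniformly, so the identity passes from trigonometric
  polynomials to the limit by dominated convergence.  The exponentials carry a minus sign to match
  \<open>\<zeta> = exp (- w)\<close>.
\<close>

lemma parseval_power_series:
  fixes c :: "nat \<Rightarrow> complex"
  assumes c: "summable (\<lambda>n. cmod (c n))"
  shows "summable (\<lambda>n. (cmod (c n))\<^sup>2)"
    and "((\<lambda>t. (cmod (\<Sum>n. c n * exp (- (\<i> * of_nat n * of_real t))))\<^sup>2)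
     has_integral 2 * pi * (\<Sum>n. (cmod (c n))\<^sup>2)) {- pi..pi}"
proof -
  let ?e = "\<lambda>n t. exp (- (\<i> * of_nat n * of_real t)) :: complex"
  have sc: "summable (\<lambda>n. cmod (c n * ?e n t))" for t
    using c by (simp add: norm_mult norm_exp_eq_Re)
  let ?B = "(\<Sum>n. cmod (c n))"
  have bd: "cmod (\<Sum>n<N. c n * ?e n t) \<le> ?B" for N t
  proof -
    have "cmod (\<Sum>n<N. c n * ?e n t) \<le> (\<Sum>n<N. cmod (c n * ?e n t))"
      by (rule norm_sum)
    also have "\<dots> = (\<Sum>n<N. cmod (c n))"
      by (simp add: norm_mult norm_exp_eq_Re)
    also have "\<dots> \<le> ?B"
      by (rule sum_le_suminf[OF c]) auto
    finally show ?thesis .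
  qed
  show ssq: "summable (\<lambda>n. (cmod (c n))\<^sup>2)"
  proof (rule summable_comparison_test'[OF summable_mult[OF c, of ?B]])
    fix n
    have "cmod (c n) \<le> ?B"
      using sum_le_suminf[OF c, of "{n}"] by auto
    then show "norm ((cmod (c n))\<^sup>2) \<le> ?B * cmod (c n)"
      by (simp add: power2_eq_square mult_right_mono)
  qed
  let ?f = "\<lambda>N t. (cmod (\<Sum>n<N. c n * ?e n t))\<^sup>2"
  let ?g = "\<lambda>t. (cmod (\<Sum>n. c n * ?e n t))\<^sup>2"
  have dom: "?g integrable_on {- pi..pi}" "(\<lambda>N. integral {- pi..pi} (?f N)) \<longlonglongrightarrow> integral {- pi..pi} ?g"
  proof -
    have 1: "?f N integrable_on {- pi..pi}" for N
      using has_integral_norm_trig_poly_square by blast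
    have 2: "(\<lambda>t. ?B\<^sup>2) integrable_on {- pi..pi}"
      by (rule integrable_const_ivl)
    have 3: "norm (?f N t) \<le> ?B\<^sup>2" for N t
      using bd[where N=N and t=t] by (simp add: power_mono)
    have 4: "(\<lambda>N. ?f N t) \<longlonglongrightarrow> ?g t" for t
      using summable_LIMSEQ[OF summable_norm_cancel[OF sc]] by (intro tendsto_intros)
    show "?g integrable_on {- pi..pi}" "(\<lambda>N. integral {- pi..pi} (?f N)) \<longlonglongrightarrow> integral {- pi..pi} ?g"
      using dominated_convergence[of ?f "{- pi..pi}" "\<lambda>t. ?B\<^sup>2" ?g] 1 2 3 4 by auto
  qed
  have "(\<lambda>N. integral {- pi..pi} (?f N)) = (\<lambda>N. 2 * pi * (\<Sum>n<N. (cmod (c n))\<^sup>2))"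
    using has_integral_norm_trig_poly_square by (intro ext integral_unique) blast
  with dom(2) have "(\<lambda>N. 2 * pi * (\<Sum>n<N. (cmod (c n))\<^sup>2)) \<longlonglongrightarrow> integral {- pi..pi} ?g"
    by simp
  moreover have "(\<lambda>N. 2 * pi * (\<Sum>n<N. (cmod (c n))\<^sup>2)) \<longlonglongrightarrow> 2 * pi * (\<Sum>n. (cmod (c n))\<^sup>2)"
    by (intro tendsto_intros summable_LIMSEQ ssq)
  ultimately have "integral {- pi..pi} ?g = 2 * pi * (\<Sum>n. (cmod (c n))\<^sup>2)"
    by (rule LIMSEQ_unique)
  with dom(1) show "(?g has_integral 2 * pi * (\<Sum>n. (cmod (c n))\<^sup>2)) {- pi..pi}"
    by (simp add: has_integral_iff)
qed

text \<open>
  After the substitution \<open>t = exp (- 2 * u)\<close> this is half of the Beta integral of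
  \<open>t ^ n * (1 - t) ^ m\<close> over the unit interval.  Splitting off one factor \<open>1 - exp (- 2 * u)\<close>
  expresses the moment for \<open>Suc m\<close> as a difference of two moments for \<open>m\<close>.
\<close>

lemma has_integral_radial_moment:
  "((\<lambda>u. exp (- (2 * (real n + 1)) * u) * (1 - exp (- 2 * u)) ^ m)
     has_integral (fact n * fact m / (2 * fact (n + m + 1)))) {0::real..}"
proof (induction m arbitrary: n)
  case 0
  show ?case
  proof -
    have "fact n / (2 * fact (n + 1)) = 1 / (2 * (real n + 1))"
      by (simp add: add.commute)
    then show ?thesis
      using has_integral_exp_minus_to_infinity[of "2 * (real n + 1)" 0] by (simp add: add.commute)
  qed
next
  case (Suc m)
  have "((\<lambda>u. exp (- (2 * (real n + 1)) * u) * (1 - exp (- 2 * u)) ^ m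
            - exp (- (2 * (real (Suc n) + 1)) * u) * (1 - exp (- 2 * u)) ^ m) has_integral
     (fact n * fact m / (2 * fact (n + m + 1)) - fact (Suc n) * fact m / (2 * fact (Suc n + m + 1)))) {0::real..}"
    by (intro has_integral_diff Suc.IH)
  also have "(\<lambda>u. exp (- (2 * (real n + 1)) * u) * (1 - exp (- 2 * u)) ^ m
            - exp (- (2 * (real (Suc n) + 1)) * u) * (1 - exp (- 2 * u)) ^ m)
     = (\<lambda>u. exp (- (2 * (real n + 1)) * u) * (1 - exp (- 2 * u)) ^ Suc m)"
  proof
    fix u :: real
    have "exp (- (2 * (real (Suc n) + 1)) * u) = exp (- (2 * (real n + 1)) * u) * exp (- 2 * u)"
      by (simp add: exp_add[symmetric] algebra_simps)
    then show "exp (- (2 * (real n + 1)) * u) * (1 - exp (- 2 * u)) ^ m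
            - exp (- (2 * (real (Suc n) + 1)) * u) * (1 - exp (- 2 * u)) ^ m
       = exp (- (2 * (real n + 1)) * u) * (1 - exp (- 2 * u)) ^ Suc m"
      by (simp only: power_Suc) (simp add: algebra_simps)
  qed
  also have "fact n * fact m / (2 * fact (n + m + 1)) - fact (Suc n) * fact m / (2 * fact (Suc n + m + 1))
     = (fact n * fact (Suc m) / (2 * fact (n + Suc m + 1)) :: real)"
    by (simp add: divide_simps) (simp add: algebra_simps)
  finally show ?case .
qed

section \<open>Holomorphic change of variables\<close>

text \<open>
  Area on \<open>complex\<close> is identified with Lebesgue measure on \<open>real^2\<close>, where derivatives are matrices
  with a Jacobian determinant, and below with the product measure, where integrals can be iterated.
\<close>

lemma lborel_complex_eq_distr_vec:
  "(lborel :: complex measure) = distr (lborel :: (real^2) measure) borel (\<lambda>v. Complex (v $ 1) (v $ 2))"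
proof (rule lborel_eqI)
  have [measurable]: "(\<lambda>v::real^2. Complex (v $ 1) (v $ 2)) \<in> borel_measurable borel"
    by (intro borel_measurable_continuous_onI) (simp add: Complex_eq, intro continuous_intros)
  fix l u :: complex
  assume lu: "\<And>b. b \<in> Basis \<Longrightarrow> l \<bullet> b \<le> u \<bullet> b"
  let ?l = "vector [Re l, Im l] :: real^2" and ?u = "vector [Re u, Im u] :: real^2"
  have eq: "(\<lambda>v::real^2. Complex (v $ 1) (v $ 2)) -` box l u = box ?l ?u"
    by (auto simp: in_box_complex_iff mem_box_cart forall_2)
  have B: "(Basis :: (real^2) set) = {axis 1 1, axis 2 1}"
    by (auto simp: Basis_vec_def UNIV_2)
  have "Re l \<le> Re u" "Im l \<le> Im u"
    using lu[of 1] lu[of \<i>] by (auto simp: Basis_complex_def)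
  then have "emeasure lborel (box ?l ?u) = ennreal ((Re u - Re l) * (Im u - Im l))"
    by (subst emeasure_lborel_box) (auto simp: B inner_axis axis_eq_axis inner_diff_left)
  then show "emeasure (distr lborel borel (\<lambda>v::real^2. Complex (v $ 1) (v $ 2))) (box l u) = (\<Prod>b\<in>Basis. (u - l) \<bullet> b)"
    by (simp add: emeasure_distr eq Basis_complex_def)
qed simp

lemma lborel_complex_eq_distr_pair:
  "(lborel :: complex measure) = distr (lborel \<Otimes>\<^sub>M lborel) borel (\<lambda>(x, y). Complex x y)"
proof (rule lborel_eqI)
  have [measurable]: "(\<lambda>(x, y). Complex x y) \<in> borel_measurable (borel \<Otimes>\<^sub>M borel)"
    unfolding borel_prod
    by (intro borel_measurable_continuous_onI) (simp add: Complex_eq case_prod_beta', intro continuous_intros)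
  fix l u :: complex
  assume lu: "\<And>b. b \<in> Basis \<Longrightarrow> l \<bullet> b \<le> u \<bullet> b"
  have eq: "(\<lambda>(x, y). Complex x y) -` box l u = box (Re l) (Re u) \<times> box (Im l) (Im u)"
    by (auto simp: in_box_complex_iff)
  have "Re l \<le> Re u" "Im l \<le> Im u"
    using lu[of 1] lu[of \<i>] by (auto simp: Basis_complex_def)
  then have "emeasure (lborel \<Otimes>\<^sub>M lborel) (box (Re l) (Re u) \<times> box (Im l) (Im u)) = ennreal ((Re u - Re l) * (Im u - Im l))"
    by (subst lborel.emeasure_pair_measure_Times) (auto simp: ennreal_mult)
  then show "emeasure (distr (lborel \<Otimes>\<^sub>M lborel) borel (\<lambda>(x, y). Complex x y)) (box l u) = (\<Prod>b\<in>Basis. (u - l) \<bullet> b)"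
    by (subst emeasure_distr) (auto simp: space_pair_measure eq Basis_complex_def)
qed simp

lemma nn_integral_complex_iterated:
  assumes [measurable]: "f \<in> borel_measurable (borel :: complex measure)"
  shows "(\<integral>\<^sup>+z. f z \<partial>lborel) = (\<integral>\<^sup>+x. \<integral>\<^sup>+y. f (Complex x y) \<partial>lborel \<partial>lborel)"
proof -
  have [measurable]: "(\<lambda>(x, y). Complex x y) \<in> borel_measurable (borel \<Otimes>\<^sub>M borel)"
    unfolding borel_prod
    by (intro borel_measurable_continuous_onI) (simp add: Complex_eq case_prod_beta', intro continuous_intros)
  have "(\<integral>\<^sup>+z. f z \<partial>lborel) = (\<integral>\<^sup>+p. f (case p of (x, y) \<Rightarrow> Complex x y) \<partial>(lborel \<Otimes>\<^sub>M lborel))"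
    by (subst lborel_complex_eq_distr_pair, rule nn_integral_distr) simp_all
  also have "\<dots> = (\<integral>\<^sup>+x. \<integral>\<^sup>+y. f (Complex x y) \<partial>lborel \<partial>lborel)"
    by (subst lborel.nn_integral_fst[symmetric]) simp_all
  finally show ?thesis .
qed

text \<open>
  A bridge between nonnegative Lebesgue integrals, which may be infinite, and gauge integrals.
\<close>

lemma nn_integral_eq_iff_has_integral:
  fixes f :: "'a::euclidean_space \<Rightarrow> real"
  assumes m: "(\<lambda>x. indicator A x * f x) \<in> borel_measurable borel" and nn: "\<And>x. x \<in> A \<Longrightarrow> f x \<ge> 0" and r: "r \<ge> 0"
  shows "(\<integral>\<^sup>+x\<in>A. ennreal (f x) \<partial>lborel) = ennreal r \<longleftrightarrow> (f has_integral r) A"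
proof
  assume "(f has_integral r) A"
  then show "(\<integral>\<^sup>+x\<in>A. ennreal (f x) \<partial>lborel) = ennreal r"
    using nn by (intro nn_integral_has_integral_lebesgue')
next
  assume "(\<integral>\<^sup>+x\<in>A. ennreal (f x) \<partial>lborel) = ennreal r"
  also have "(\<integral>\<^sup>+x\<in>A. ennreal (f x) \<partial>lborel) = (\<integral>\<^sup>+x. ennreal (indicator A x * f x) \<partial>lborel)"
    by (intro nn_integral_cong) (auto simp: indicator_def)
  finally have "((\<lambda>x. indicator A x * f x) has_integral r) UNIV"
    using m nn r by (intro nn_integral_has_integral) (auto simp: indicator_def)
  also have "(\<lambda>x. indicator A x * f x) = (\<lambda>x. if x \<in> A then f x else 0)"
    by (auto simp: indicator_def)
  finally show "(f has_integral r) A"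
    by (simp only: has_integral_restrict_UNIV)
qed

text \<open>Two values with the same finite candidates are either equal and finite, or both infinite.\<close>

lemma ennreal_eqI_finite:
  assumes "\<And>r. r \<ge> 0 \<Longrightarrow> a = ennreal r \<longleftrightarrow> b = ennreal r"
  shows "a = (b :: ennreal)"
  using assms by (metis ennreal_cases)

text \<open>
  For a nonnegative integrand the equivalence of absolute integrability contained in the change of
  variables theorem makes the formula hold also when one side, hence the other, is infinite.
\<close>

lemma nn_integral_vec_change_of_variables:
  fixes f :: "real^'n::{finite,wellorder} \<Rightarrow> real" and g :: "real^'n::_ \<Rightarrow> real^'n::_"
  assumes S: "S \<in> sets borel"
    and der: "\<And>x. x \<in> S \<Longrightarrow> (g has_derivative g' x) (at x within S)"
    and inj: "inj_on g S"
    and m1: "(\<lambda>x. indicator (g ` S) x * f x) \<in> borel_measurable borel"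
    and m2: "(\<lambda>x. indicator S x * (\<bar>det (matrix (g' x))\<bar> * f (g x))) \<in> borel_measurable borel"
    and nn: "\<And>x. x \<in> g ` S \<Longrightarrow> f x \<ge> 0"
  shows "(\<integral>\<^sup>+x\<in>g ` S. ennreal (f x) \<partial>lborel) = (\<integral>\<^sup>+x\<in>S. ennreal (\<bar>det (matrix (g' x))\<bar> * f (g x)) \<partial>lborel)"
proof (rule ennreal_eqI_finite)
  fix r :: real assume r: "r \<ge> 0"
  have S': "S \<in> sets lebesgue" using S by auto
  let ?h = "\<lambda>x. \<bar>det (matrix (g' x))\<bar> * f (g x)"
  have abs: "(h has_integral r) A \<longleftrightarrow> h absolutely_integrable_on A \<and> integral A h = r"
    if "\<And>x. x \<in> A \<Longrightarrow> h x \<ge> 0" for h :: "real^'n::{finite,wellorder} \<Rightarrow> real" and A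
    using that nonnegative_absolutely_integrable_1[of h A]
    by (auto simp: has_integral_iff absolutely_integrable_on_def)
  have "(\<lambda>x. \<bar>det (matrix (g' x))\<bar> *\<^sub>R vec (f (g x)) :: real ^ 1) absolutely_integrable_on S \<and>
           integral S (\<lambda>x. \<bar>det (matrix (g' x))\<bar> *\<^sub>R vec (f(g x))) = (vec r :: real ^ 1)
         \<longleftrightarrow> (\<lambda>x. vec (f x) :: real ^ 1) absolutely_integrable_on (g ` S) \<and>
           integral (g ` S) (\<lambda>x. vec (f x)) = (vec r :: real ^ 1)"
    by (rule has_absolute_integral_change_of_variables[OF S' der inj])
  then have "?h absolutely_integrable_on S \<and> integral S ?h = r \<longleftrightarrow> f absolutely_integrable_on (g ` S) \<and> integral (g ` S) f = r"
    by (simp add: absolutely_integrable_on_1_iff integral_on_1_eq)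
  then have "(?h has_integral r) S \<longleftrightarrow> (f has_integral r) (g ` S)"
    using nn by (simp add: abs)
  then show "(\<integral>\<^sup>+x\<in>g ` S. ennreal (f x) \<partial>lborel) = ennreal r \<longleftrightarrow> (\<integral>\<^sup>+x\<in>S. ennreal (?h x) \<partial>lborel) = ennreal r"
    using nn r by (subst (1 2) nn_integral_eq_iff_has_integral) (auto intro: m1 m2)
qed

text \<open>
  By the Cauchy-Riemann equations, the real Jacobian determinant is the squared modulus of the
  complex derivative.
\<close>

lemma nn_integral_holomorphic_change_of_variables:
  fixes f :: "complex \<Rightarrow> real" and \<phi> :: "complex \<Rightarrow> complex"
  assumes S: "S \<in> sets borel"
    and der: "\<And>z. z \<in> S \<Longrightarrow> (\<phi> has_field_derivative \<phi>' z) (at z within S)"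
    and inj: "inj_on \<phi> S"
    and m1: "(\<lambda>z. indicator (\<phi> ` S) z * f z) \<in> borel_measurable borel"
    and m2: "(\<lambda>z. indicator S z * ((cmod (\<phi>' z))\<^sup>2 * f (\<phi> z))) \<in> borel_measurable borel"
    and nn: "\<And>z. z \<in> \<phi> ` S \<Longrightarrow> f z \<ge> 0"
  shows "(\<integral>\<^sup>+z\<in>\<phi> ` S. ennreal (f z) \<partial>lborel) = (\<integral>\<^sup>+z\<in>S. ennreal ((cmod (\<phi>' z))\<^sup>2 * f (\<phi> z)) \<partial>lborel)"
proof -
  define c where "c = (\<lambda>v::real^2. Complex (v $ 1) (v $ 2))"
  define d where "d = (\<lambda>z. vector [Re z, Im z] :: real^2)"
  have cd [simp]: "c (d z) = z" "d (c v) = v" for z v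
    by (auto simp: c_def d_def vec_eq_iff forall_2)
  have linc: "bounded_linear c"
    unfolding c_def by (intro linear_conv_bounded_linear[THEN iffD1] linearI) (auto simp: complex_eq_iff)
  have lind: "bounded_linear d"
    unfolding d_def by (intro linear_conv_bounded_linear[THEN iffD1] linearI) (auto simp: vec_eq_iff forall_2)
  have [measurable]: "c \<in> borel_measurable borel"
    by (intro borel_measurable_continuous_onI linear_continuous_on linc)
  have lb: "(lborel :: complex measure) = distr lborel borel c"
    unfolding c_def by (rule lborel_complex_eq_distr_vec)
  have trans: "(\<integral>\<^sup>+z\<in>A. ennreal (h z) \<partial>lborel) = (\<integral>\<^sup>+v\<in>c -` A. ennreal (h (c v)) \<partial>lborel)"
    if [measurable]: "(\<lambda>z. indicator A z * h z) \<in> borel_measurable borel" for A h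
  proof -
    have "(\<integral>\<^sup>+z\<in>A. ennreal (h z) \<partial>lborel) = (\<integral>\<^sup>+z. ennreal (indicator A z * h z) \<partial>lborel)"
      by (intro nn_integral_cong) (auto simp: indicator_def)
    also have "\<dots> = (\<integral>\<^sup>+v. ennreal (indicator A (c v) * h (c v)) \<partial>lborel)"
      by (subst lb, rule nn_integral_distr) simp_all
    also have "\<dots> = (\<integral>\<^sup>+v\<in>c -` A. ennreal (h (c v)) \<partial>lborel)"
      by (intro nn_integral_cong) (auto simp: indicator_def)
    finally show ?thesis .
  qed
  let ?g = "\<lambda>v. d (\<phi> (c v))" and ?g' = "\<lambda>v x. d (\<phi>' (c v) * c x)"
  let ?T = "c -` S"
  have img: "?g ` ?T = c -` (\<phi> ` S)"
  proof safe
    fix v z assume *: "c v = \<phi> z" "z \<in> S"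
    then have "v = ?g (d z)" using cd by metis
    with * show "v \<in> ?g ` ?T" by (intro image_eqI[of _ _ "d z"]) auto
  qed auto
  have der': "(?g has_derivative ?g' v) (at v within ?T)" if "v \<in> ?T" for v
  proof -
    have "(\<phi> has_derivative (*) (\<phi>' (c v))) (at (c v) within c ` ?T)"
      using der[of "c v"] that
      by (auto simp: has_field_derivative_def intro: has_derivative_subset)
    from has_derivative_in_compose[OF bounded_linear_imp_has_derivative[OF linc] this]
    have "((\<lambda>v. \<phi> (c v)) has_derivative (\<lambda>x. \<phi>' (c v) * c x)) (at v within ?T)"
      by simp
    from bounded_linear.has_derivative[OF lind this] show ?thesis .
  qed
  have det: "det (matrix (?g' v)) = (cmod (\<phi>' (c v)))\<^sup>2" for v
    unfolding cmod_power2 by (simp add: det_2 matrix_def c_def d_def axis_def power2_eq_square)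
  have "(\<integral>\<^sup>+z\<in>\<phi> ` S. ennreal (f z) \<partial>lborel) = (\<integral>\<^sup>+v\<in>c -` (\<phi> ` S). ennreal (f (c v)) \<partial>lborel)"
    by (rule trans[OF m1])
  also have "\<dots> = (\<integral>\<^sup>+v\<in>?g ` ?T. ennreal (f (c v)) \<partial>lborel)"
    by (simp only: img)
  also have "\<dots> = (\<integral>\<^sup>+v\<in>?T. ennreal (\<bar>det (matrix (?g' v))\<bar> * f (c (?g v))) \<partial>lborel)"
  proof (rule nn_integral_vec_change_of_variables)
    show "?T \<in> sets borel"
      using measurable_sets[of c borel borel S] S by simp
    show "inj_on ?g ?T"
      using inj by (intro inj_onI) (metis cd inj_onD vimageE)
    have "(\<lambda>v. indicator (\<phi> ` S) (c v) * f (c v)) \<in> borel_measurable borel"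
      using measurable_compose[OF _ m1, of c borel] by simp
    then show "(\<lambda>v. indicator (?g ` ?T) v * f (c v)) \<in> borel_measurable borel"
      unfolding img by (simp add: indicator_def)
    have "(\<lambda>v. indicator S (c v) * ((cmod (\<phi>' (c v)))\<^sup>2 * f (\<phi> (c v)))) \<in> borel_measurable borel"
      using measurable_compose[OF _ m2, of c borel] by simp
    then show "(\<lambda>v. indicator ?T v * (\<bar>det (matrix (?g' v))\<bar> * f (c (?g v)))) \<in> borel_measurable borel"
      unfolding det by (simp add: indicator_def)
  qed (use der' nn img in auto)
  also have "\<dots> = (\<integral>\<^sup>+z\<in>S. ennreal ((cmod (\<phi>' z))\<^sup>2 * f (\<phi> z)) \<partial>lborel)"
    unfolding det by (simp add: trans[OF m2])
  finally show ?thesis .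
qed

section \<open>The half-strip as polar coordinates for the half-plane\<close>

text \<open>
  The range of \<open>Im w\<close> is half-open on the side that makes \<open>- Ln\<close> the inverse of \<open>\<zeta> = exp (- w)\<close>,
  since \<open>Im (Ln \<zeta>)\<close> lies in \<open>]- \<pi>, \<pi>]\<close>.
\<close>

definition half_strip :: "complex set" where
  "half_strip = {w. 0 < Re w \<and> - pi \<le> Im w \<and> Im w < pi}"

text \<open>
  The Cayley transform from the disc to the half-plane, in the logarithmic coordinate
  \<open>\<zeta> = exp (- w)\<close>.
\<close>

definition strip_map :: "complex \<Rightarrow> complex" where
  "strip_map w = \<i> * (1 + exp (- w)) / (1 - exp (- w))"

lemma half_strip_borel [measurable]: "half_strip \<in> sets borel"
  unfolding half_strip_def by measurable

lemma half_strip_exp: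
  assumes "w \<in> half_strip"
  shows "cmod (exp (- w)) < 1" "exp (- w) \<noteq> 1"
proof -
  show *: "cmod (exp (- w)) < 1" using assms by (simp add: half_strip_def)
  then show "exp (- w) \<noteq> 1" by (metis norm_one less_irrefl)
qed

text \<open>
  Parseval's identity on the circle of radius \<open>exp (- u)\<close>, applied to the coefficients
  \<open>a n * exp (- u) ^ n\<close>.  They are absolutely summable since the series converges on a larger circle.
\<close>

lemma nn_integral_circle_power_series:
  assumes h: "\<And>z. cmod z < 1 \<Longrightarrow> (\<lambda>n. a n * z ^ n) sums h z" and u: "u > 0"
  shows "(\<integral>\<^sup>+t\<in>{- pi..<pi}. ennreal ((cmod (h (exp (- Complex u t))))\<^sup>2) \<partial>lborel)
     = (\<Sum>n. ennreal (2 * pi * (cmod (a n))\<^sup>2 * exp (- (2 * real n * u))))"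
proof -
  let ?c = "\<lambda>n. a n * of_real (exp (- u)) ^ n"
  obtain r where r: "exp (- u) < r" "r < 1"
    using u dense[of "exp (- u)" 1] by auto
  have r0: "r > 0" using r(1) exp_gt_zero[of "- u"] by linarith
  have sc: "summable (\<lambda>n. cmod (?c n))"
    by (rule powser_insidea[where x = "of_real r"]) (use h[of "of_real r"] r r0 in \<open>auto simp: sums_iff\<close>)
  have eq: "h (exp (- Complex u t)) = (\<Sum>n. ?c n * exp (- (\<i> * of_nat n * of_real t)))" for t
  proof -
    have "h (exp (- Complex u t)) = (\<Sum>n. a n * (\<lambda>n. exp (- Complex u t) ^ n) n)"
      using h[of "exp (- Complex u t)"] u by (simp add: sums_iff)
    also have "(\<lambda>n. exp (- Complex u t) ^ n) = (\<lambda>n. of_real (exp (- u)) ^ n * exp (- (\<i> * of_nat n * of_real t)))"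
    proof
      fix n
      have "exp (- Complex u t) ^ n = exp (of_nat n * (- Complex u t))"
        by (rule exp_of_nat_mult[symmetric])
      also have "of_nat n * (- Complex u t) = of_nat n * of_real (- u) + - (\<i> * of_nat n * of_real t)"
        by (simp add: Complex_eq algebra_simps)
      also have "exp \<dots> = of_real (exp (- u)) ^ n * exp (- (\<i> * of_nat n * of_real t))"
        by (simp only: exp_add exp_of_nat_mult exp_of_real)
      finally show "exp (- Complex u t) ^ n = of_real (exp (- u)) ^ n * exp (- (\<i> * of_nat n * of_real t))" .
    qed
    finally show ?thesis by (simp add: mult.assoc)
  qed
  have sq: "(cmod (?c n))\<^sup>2 = (cmod (a n))\<^sup>2 * exp (- (2 * real n * u))" for n
  proof -
    have "(exp (- u) ^ n)\<^sup>2 = exp (- (2 * real n * u))"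
      by (simp add: exp_of_nat_mult[symmetric] power2_eq_square exp_add[symmetric])
    then show ?thesis by (simp add: norm_mult norm_power power_mult_distrib)
  qed
  have "((\<lambda>t. (cmod (h (exp (- Complex u t))))\<^sup>2) has_integral 2 * pi * (\<Sum>n. (cmod (?c n))\<^sup>2)) {- pi..pi}"
    using parseval_power_series(2)[OF sc] by (simp only: eq)
  then have "((\<lambda>t. (cmod (h (exp (- Complex u t))))\<^sup>2) has_integral 2 * pi * (\<Sum>n. (cmod (?c n))\<^sup>2)) {- pi..<pi}"
    by (subst has_integral_spike_set_eq[where T = "{- pi..pi}"]) (rule negligible_subset[of "{pi}"]; auto)+
  then have "(\<integral>\<^sup>+t\<in>{- pi..<pi}. ennreal ((cmod (h (exp (- Complex u t))))\<^sup>2) \<partial>lborel) = ennreal (2 * pi * (\<Sum>n. (cmod (?c n))\<^sup>2))"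
    by (intro nn_integral_has_integral_lebesgue') auto
  also have "\<dots> = ennreal (\<Sum>n. 2 * pi * (cmod (?c n))\<^sup>2)"
    using parseval_power_series(1)[OF sc] by (simp only: suminf_mult)
  also have "\<dots> = (\<Sum>n. ennreal (2 * pi * (cmod (?c n))\<^sup>2))"
    by (rule suminf_ennreal2[symmetric]) (auto intro!: summable_mult parseval_power_series(1)[OF sc])
  finally show ?thesis by (simp only: sq mult.assoc)
qed

text \<open>
  The weighted area integral of \<open>\<bar>h\<bar>\<^sup>2\<close> over the disc in the coordinates \<open>\<zeta> = exp (- w)\<close>; the factor
  \<open>exp (- 2 * Re w)\<close> is their Jacobian.  Parseval's identity evaluates the integral over \<open>Im w\<close>,
  and each term of the resulting series is integrated over \<open>Re w\<close> as a radial moment.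
\<close>

lemma nn_integral_half_strip_power_series:
  assumes h: "\<And>z. cmod z < 1 \<Longrightarrow> (\<lambda>n. a n * z ^ n) sums h z" and cont: "continuous_on (ball 0 1) h"
  shows "(\<integral>\<^sup>+w\<in>half_strip. ennreal ((cmod (h (exp (- w))))\<^sup>2 * (exp (- (2 * Re w)) * (1 - exp (- (2 * Re w))) ^ m)) \<partial>lborel)
     = (\<Sum>n. ennreal (pi * (cmod (a n))\<^sup>2 * (fact n * fact m / fact (n + m + 1))))"
proof -
  let ?w = "\<lambda>u::real. exp (- (2 * u)) * (1 - exp (- (2 * u))) ^ m"
  let ?G = "\<lambda>w. (cmod (h (exp (- w))))\<^sup>2 * ?w (Re w)"
  have "continuous_on half_strip ?G"
    by (intro continuous_intros continuous_on_compose2[OF cont]) (auto simp: half_strip_def)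
  from borel_measurable_continuous_on_indicator[OF half_strip_borel this]
  have [measurable]: "(\<lambda>w. indicator half_strip w * ?G w) \<in> borel_measurable borel"
    by simp
  have "(\<integral>\<^sup>+w\<in>half_strip. ennreal (?G w) \<partial>lborel) = (\<integral>\<^sup>+w. ennreal (indicator half_strip w * ?G w) \<partial>lborel)"
    by (intro nn_integral_cong) (auto simp: indicator_def)
  also have "\<dots> = (\<integral>\<^sup>+u. \<integral>\<^sup>+t. ennreal (indicator half_strip (Complex u t) * ?G (Complex u t)) \<partial>lborel \<partial>lborel)"
    by (rule nn_integral_complex_iterated) measurable
  also have "\<dots> = (\<integral>\<^sup>+u. (\<Sum>n. ennreal (2 * pi * (cmod (a n))\<^sup>2 * (exp (- (2 * (real n + 1)) * u) * (1 - exp (- 2 * u)) ^ m)) * indicator {0<..} u) \<partial>lborel)"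
  proof (rule nn_integral_cong)
    fix u :: real
    show "(\<integral>\<^sup>+t. ennreal (indicator half_strip (Complex u t) * ?G (Complex u t)) \<partial>lborel)
       = (\<Sum>n. ennreal (2 * pi * (cmod (a n))\<^sup>2 * (exp (- (2 * (real n + 1)) * u) * (1 - exp (- 2 * u)) ^ m)) * indicator {0<..} u)"
    proof (cases "u > 0")
      case False
      then show ?thesis by (simp add: half_strip_def)
    next
      case True
      have w0: "?w u \<ge> 0" using True by simp
      have circ_meas: "(\<lambda>t. ennreal ((cmod (h (exp (- Complex u t))))\<^sup>2) * indicator {- pi..<pi} t) \<in> borel_measurable lborel"
      proof -
        have "continuous_on {- pi..<pi} (\<lambda>t. (cmod (h (exp (- Complex u t))))\<^sup>2)"
          unfolding Complex_eq using True
          by (intro continuous_intros continuous_on_compose2[OF cont]) auto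
        from borel_measurable_continuous_on_indicator[OF _ this]
        have "(\<lambda>t. ennreal (indicator {- pi..<pi} t *\<^sub>R (cmod (h (exp (- Complex u t))))\<^sup>2)) \<in> borel_measurable borel"
          by (intro measurable_compose[OF _ measurable_ennreal]) simp
        also have "(\<lambda>t. ennreal (indicator {- pi..<pi} t *\<^sub>R (cmod (h (exp (- Complex u t))))\<^sup>2))
           = (\<lambda>t. ennreal ((cmod (h (exp (- Complex u t))))\<^sup>2) * indicator {- pi..<pi} t)"
          by (auto simp: indicator_def)
        finally show ?thesis by simp
      qed
      have "(\<integral>\<^sup>+t. ennreal (indicator half_strip (Complex u t) * ?G (Complex u t)) \<partial>lborel)
        = (\<integral>\<^sup>+t. ennreal (?w u) * (ennreal ((cmod (h (exp (- Complex u t))))\<^sup>2) * indicator {- pi..<pi} t) \<partial>lborel)"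
        using True w0 by (intro nn_integral_cong) (auto simp: half_strip_def indicator_def ennreal_mult' mult.commute)
      also have "\<dots> = ennreal (?w u) * (\<integral>\<^sup>+t\<in>{- pi..<pi}. ennreal ((cmod (h (exp (- Complex u t))))\<^sup>2) \<partial>lborel)"
        by (rule nn_integral_cmult[OF circ_meas])
      also have "\<dots> = ennreal (?w u) * (\<Sum>n. ennreal (2 * pi * (cmod (a n))\<^sup>2 * exp (- (2 * real n * u))))"
        by (subst nn_integral_circle_power_series[OF h True]) auto
      also have "\<dots> = (\<Sum>n. ennreal (?w u) * ennreal (2 * pi * (cmod (a n))\<^sup>2 * exp (- (2 * real n * u))))"
        by simp
      also have "\<dots> = (\<Sum>n. ennreal (2 * pi * (cmod (a n))\<^sup>2 * (exp (- (2 * (real n + 1)) * u) * (1 - exp (- 2 * u)) ^ m)) * indicator {0<..} u)"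
      proof (rule suminf_cong)
        fix n
        have "exp (- (2 * (real n + 1)) * u) = exp (- (2 * real n * u)) * exp (- (2 * u))"
          by (simp add: exp_add[symmetric] algebra_simps)
        then show "ennreal (?w u) * ennreal (2 * pi * (cmod (a n))\<^sup>2 * exp (- (2 * real n * u)))
           = ennreal (2 * pi * (cmod (a n))\<^sup>2 * (exp (- (2 * (real n + 1)) * u) * (1 - exp (- 2 * u)) ^ m)) * indicator {0<..} u"
          using True w0 by (simp add: ennreal_mult'[symmetric] mult_ac)
      qed
      finally show ?thesis .
    qed
  qed
  also have "\<dots> = (\<Sum>n. \<integral>\<^sup>+u\<in>{0<..}. ennreal (2 * pi * (cmod (a n))\<^sup>2 * (exp (- (2 * (real n + 1)) * u) * (1 - exp (- 2 * u)) ^ m)) \<partial>lborel)"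
    by (rule nn_integral_suminf) measurable
  also have "\<dots> = (\<Sum>n. ennreal (pi * (cmod (a n))\<^sup>2 * (fact n * fact m / fact (n + m + 1))))"
  proof (rule suminf_cong)
    fix n
    have "((\<lambda>u. 2 * pi * (cmod (a n))\<^sup>2 * (exp (- (2 * (real n + 1)) * u) * (1 - exp (- 2 * u)) ^ m))
      has_integral 2 * pi * (cmod (a n))\<^sup>2 * (fact n * fact m / (2 * fact (n + m + 1)))) {0::real..}"
      by (intro has_integral_mult_right has_integral_radial_moment)
    then have "((\<lambda>u. 2 * pi * (cmod (a n))\<^sup>2 * (exp (- (2 * (real n + 1)) * u) * (1 - exp (- 2 * u)) ^ m))
      has_integral 2 * pi * (cmod (a n))\<^sup>2 * (fact n * fact m / (2 * fact (n + m + 1)))) {0::real<..}"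
      by (subst has_integral_spike_set_eq[where T = "{0..}"]) (rule negligible_subset[of "{0}"]; auto)+
    then have "(\<integral>\<^sup>+u\<in>{0<..}. ennreal (2 * pi * (cmod (a n))\<^sup>2 * (exp (- (2 * (real n + 1)) * u) * (1 - exp (- 2 * u)) ^ m)) \<partial>lborel)
      = ennreal (2 * pi * (cmod (a n))\<^sup>2 * (fact n * fact m / (2 * fact (n + m + 1))))"
      by (intro nn_integral_has_integral_lebesgue') auto
    then show "(\<integral>\<^sup>+u\<in>{0<..}. ennreal (2 * pi * (cmod (a n))\<^sup>2 * (exp (- (2 * (real n + 1)) * u) * (1 - exp (- 2 * u)) ^ m)) \<partial>lborel)
      = ennreal (pi * (cmod (a n))\<^sup>2 * (fact n * fact m / fact (n + m + 1)))"
      by simp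
  qed
  finally show ?thesis .
qed

lemma Im_cayley:
  assumes "\<zeta> \<noteq> 1"
  shows "Im (\<i> * (1 + \<zeta>) / (1 - \<zeta>)) = (1 - (cmod \<zeta>)\<^sup>2) / (cmod (1 - \<zeta>))\<^sup>2"
proof -
  have "\<i> * (1 + \<zeta>) / (1 - \<zeta>) = \<i> * (1 + \<zeta>) * cnj (1 - \<zeta>) / of_real ((cmod (1 - \<zeta>))\<^sup>2)"
    using assms by (simp add: complex_norm_square divide_simps del: of_real_power)
  also have "Im \<dots> = Im (\<i> * (1 + \<zeta>) * cnj (1 - \<zeta>)) / (cmod (1 - \<zeta>))\<^sup>2"
    by (simp only: Im_divide_of_real)
  also have "Im (\<i> * (1 + \<zeta>) * cnj (1 - \<zeta>)) = 1 - (cmod \<zeta>)\<^sup>2"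
    unfolding cmod_power2 by (simp add: algebra_simps power2_eq_square)
  finally show ?thesis .
qed

lemma strip_map_has_field_derivative:
  assumes "w \<in> half_strip"
  shows "(strip_map has_field_derivative (- 2 * \<i> * exp (- w) / (1 - exp (- w))\<^sup>2)) (at w within A)"
proof -
  have n: "1 - exp (- w) \<noteq> 0" using half_strip_exp[OF assms] by auto
  have num: "((\<lambda>w. \<i> * (1 + exp (- w))) has_field_derivative - (\<i> * exp (- w))) (at w within A)"
    by (auto intro!: derivative_eq_intros)
  have den: "((\<lambda>w. 1 - exp (- w)) has_field_derivative exp (- w)) (at w within A)"
    by (auto intro!: derivative_eq_intros)
  have "- (\<i> * e) * (1 - e) - \<i> * (1 + e) * e = - 2 * \<i> * e" for e :: complex
    by (simp add: algebra_simps)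
  then show ?thesis
    using DERIV_divide[OF num den n] unfolding strip_map_def[abs_def] by (simp only: power2_eq_square)
qed

lemma inj_on_strip_map: "inj_on strip_map half_strip"
proof (rule inj_onI)
  fix v w assume vw: "v \<in> half_strip" "w \<in> half_strip" and eq: "strip_map v = strip_map w"
  have cayley_inj: "x = y" if ne: "x \<noteq> 1" "y \<noteq> 1" and e: "\<i> * (1 + x) / (1 - x) = \<i> * (1 + y) / (1 - y)" for x y :: complex
  proof -
    have "1 - x \<noteq> 0" "1 - y \<noteq> 0" using ne by auto
    then have "\<i> * (1 + x) * (1 - y) = \<i> * (1 + y) * (1 - x)"
      using frac_eq_eq e by blast
    moreover have "2 * \<i> * (x - y) = \<i> * (1 + x) * (1 - y) - \<i> * (1 + y) * (1 - x)"
      by (simp add: algebra_simps)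
    ultimately have "2 * \<i> * (x - y) = 0" by (simp only: right_minus_eq) 
    then show ?thesis by simp
  qed
  have "exp (- v) = exp (- w)"
    by (rule cayley_inj) (use vw half_strip_exp eq in \<open>auto simp only: strip_map_def\<close>)
  moreover have "\<bar>Im (- v) - Im (- w)\<bar> < 2 * pi" using vw by (auto simp: half_strip_def)
  ultimately have "- v = - w" using exp_complex_eqI by blast
  then show "v = w" by simp
qed

text \<open>
  The inverse is \<open>- Ln ((z - \<i>) / (z + \<i>))\<close>.  The exceptional point \<open>\<i>\<close> corresponds to the centre of
  the disc, which \<open>exp (- w)\<close> never attains.
\<close>

lemma strip_map_image: "strip_map ` half_strip = upper_half_plane - {\<i>}"
proof (intro equalityI subsetI)
  fix z assume "z \<in> strip_map ` half_strip"
  then obtain w where w: "w \<in> half_strip" "z = strip_map w" by auto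
  note n = half_strip_exp(1)[OF w(1)] and n1 = half_strip_exp(2)[OF w(1)]
  have "Im z > 0"
    unfolding w strip_map_def Im_cayley[OF n1] using n n1 by (simp add: power_less_one_iff del: norm_exp_eq_Re)
  moreover have "z \<noteq> \<i>"
  proof
    assume "z = \<i>"
    then have "1 + exp (- w) = 1 - exp (- w)"
      using n1 by (simp add: w strip_map_def divide_simps)
    then show False by simp
  qed
  ultimately show "z \<in> upper_half_plane - {\<i>}" by (simp add: upper_half_plane_def)
next
  fix z assume "z \<in> upper_half_plane - {\<i>}"
  then have z: "Im z > 0" "z \<noteq> \<i>" by (auto simp: upper_half_plane_def)
  have zi: "z + \<i> \<noteq> 0" using z by (auto simp: complex_eq_iff)
  define \<zeta> where "\<zeta> = (z - \<i>) / (z + \<i>)"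
  have \<zeta>0: "\<zeta> \<noteq> 0" using z zi by (simp add: \<zeta>_def)
  have "(cmod (z - \<i>))\<^sup>2 < (cmod (z + \<i>))\<^sup>2"
    unfolding cmod_power2 using z by (simp add: power2_eq_square algebra_simps)
  then have "cmod (z - \<i>) < cmod (z + \<i>)" by (rule power_less_imp_less_base) simp
  then have \<zeta>1: "cmod \<zeta> < 1" using zi by (simp add: \<zeta>_def norm_divide)
  have "- Ln \<zeta> \<in> half_strip"
    using \<zeta>0 \<zeta>1 mpi_less_Im_Ln[OF \<zeta>0] Im_Ln_le_pi[OF \<zeta>0] by (simp add: half_strip_def Re_Ln)
  moreover have "strip_map (- Ln \<zeta>) = z"
  proof -
    have e: "1 + \<zeta> = 2 * z / (z + \<i>)" "1 - \<zeta> = 2 * \<i> / (z + \<i>)"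
      using zi by (simp_all add: \<zeta>_def divide_simps)
    have "strip_map (- Ln \<zeta>) = \<i> * (1 + \<zeta>) / (1 - \<zeta>)"
      using \<zeta>0 by (simp add: strip_map_def)
    also have "\<dots> = \<i> * (2 * z / (z + \<i>)) / (2 * \<i> / (z + \<i>))"
      by (simp only: e)
    also have "\<dots> = z"
      using zi by simp
    finally show ?thesis .
  qed
  ultimately show "z \<in> strip_map ` half_strip" by (metis imageI)
qed

section \<open>Transfer to the disc and the inequality\<close>

text \<open>
  Up to a constant, this is the unitary map from the Bergman space of the half-plane onto that of
  the disc.
\<close>

definition disc_transfer :: "(complex \<Rightarrow> complex) \<Rightarrow> complex \<Rightarrow> complex" where
  "disc_transfer F \<zeta> = F (\<i> * (1 + \<zeta>) / (1 - \<zeta>)) / (1 - \<zeta>)\<^sup>2"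

lemma disc_transfer_holomorphic:
  assumes "F holomorphic_on upper_half_plane"
  shows "disc_transfer F holomorphic_on ball 0 1"
proof -
  have n1: "1 - \<zeta> \<noteq> 0" if "\<zeta> \<in> ball 0 1" for \<zeta> :: complex
    using that by (metis dist_0_norm eq_iff_diff_eq_0 less_irrefl mem_ball norm_one)
  have "(\<lambda>\<zeta>. \<i> * (1 + \<zeta>) / (1 - \<zeta>)) ` ball 0 1 \<subseteq> upper_half_plane"
  proof (clarsimp simp: upper_half_plane_def simp del: Im_divide)
    fix \<zeta> :: complex assume z: "cmod \<zeta> < 1"
    then have "\<zeta> \<noteq> 1" by auto
    then show "0 < Im (\<i> * (1 + \<zeta>) / (1 - \<zeta>))"
      unfolding Im_cayley[OF \<open>\<zeta> \<noteq> 1\<close>] using z by (simp add: power_less_one_iff)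
  qed
  then have "(F \<circ> (\<lambda>\<zeta>. \<i> * (1 + \<zeta>) / (1 - \<zeta>))) holomorphic_on ball 0 1"
    by (intro holomorphic_on_compose_gen[OF _ assms] holomorphic_intros n1)
  then show ?thesis
    unfolding disc_transfer_def by (auto intro!: holomorphic_intros simp: o_def dest: n1)
qed

text \<open>
  With \<open>D = \<bar>1 - \<zeta>\<bar>\<^sup>2\<close>, the Jacobian contributes \<open>D\<close> to the power \<open>-2\<close>, the factor \<open>\<bar>F\<bar>\<close> to the power
  \<open>2 * Suc m\<close> contributes \<open>D ^ (2 * Suc m)\<close>, and the power of the imaginary part contributes \<open>D\<close> to the
  power \<open>- 2 * m\<close>; these cancel.
\<close>

lemma half_plane_integrand_pullback:
  assumes w: "w \<in> half_strip"
  shows "(cmod (- 2 * \<i> * exp (- w) / (1 - exp (- w))\<^sup>2))\<^sup>2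
      * (cmod (F (strip_map w)) ^ (2 * Suc m) * Im (strip_map w) ^ (2 * m))
    = 4 * ((cmod (disc_transfer F (exp (- w)) ^ Suc m))\<^sup>2 * (exp (- (2 * Re w)) * (1 - exp (- (2 * Re w))) ^ (2 * m)))"
proof -
  define \<zeta> where "\<zeta> = exp (- w)"
  have n1: "\<zeta> \<noteq> 1" using half_strip_exp[OF w] by (simp add: \<zeta>_def)
  define D where "D = (cmod (1 - \<zeta>))\<^sup>2"
  have D: "D > 0" using n1 by (simp add: D_def)
  have q: "exp (- (2 * Re w)) = (cmod \<zeta>)\<^sup>2"
    by (simp add: \<zeta>_def power2_eq_square exp_add[symmetric])
  define g where "g = cmod (disc_transfer F \<zeta>)"
  have Fg: "cmod (F (strip_map w)) = g * D"
    using n1 by (simp add: g_def D_def disc_transfer_def strip_map_def \<zeta>_def norm_divide norm_power)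
  have Imd: "Im (strip_map w) = (1 - (cmod \<zeta>)\<^sup>2) / D"
    using Im_cayley[OF n1] by (simp add: strip_map_def \<zeta>_def[symmetric] D_def)
  have jac: "(cmod (- 2 * \<i> * exp (- w) / (1 - exp (- w))\<^sup>2))\<^sup>2 = 4 * (cmod \<zeta>)\<^sup>2 / D\<^sup>2"
    unfolding \<zeta>_def[symmetric]
    by (simp add: norm_divide norm_mult norm_power power_divide power_mult_distrib D_def)
  have pow: "cmod (disc_transfer F (exp (- w)) ^ Suc m) = g ^ Suc m"
    by (simp only: norm_power g_def \<zeta>_def)
  have "4 * (cmod \<zeta>)\<^sup>2 / D\<^sup>2 * ((g * D) ^ (2 * Suc m) * ((1 - (cmod \<zeta>)\<^sup>2) / D) ^ (2 * m))
    = 4 * ((g ^ Suc m)\<^sup>2 * ((cmod \<zeta>)\<^sup>2 * (1 - (cmod \<zeta>)\<^sup>2) ^ (2 * m)))"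
  proof -
    have "g ^ (2 * Suc m) = (g ^ Suc m)\<^sup>2"
      by (simp only: power_mult[symmetric] mult.commute)
    moreover have "D ^ (2 * Suc m) = D\<^sup>2 * D ^ (2 * m)"
      by (simp add: power_add[symmetric] power2_eq_square)
    ultimately show ?thesis
      using D by (simp only: power_mult_distrib power_divide) (simp add: field_simps)
  qed
  then show ?thesis
    by (simp only: jac Fg Imd q pow)
qed

text \<open>
  The Beta values \<open>fact n * fact (2 * m) / fact (n + 2 * m + 1)\<close> are the reciprocals of
  \<open>(2 * m + 1) * ((n + (2 * m + 1)) choose n)\<close>, which turns the integral into the weighted sum of
  the discrete inequality for the power \<open>s = Suc m\<close>.
\<close>

lemma half_plane_integral_eq_coeff_sum:
  assumes F: "F holomorphic_on upper_half_plane"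
    and a: "\<And>z. cmod z < 1 \<Longrightarrow> (\<lambda>n. fps_nth a n * z ^ n) sums disc_transfer F z"
  shows "(\<integral>\<^sup>+z\<in>upper_half_plane. ennreal (cmod (F z) ^ (2 * Suc m) * Im z ^ (2 * m)) \<partial>lborel)
    = ennreal (4 * pi / (2 * real m + 1)) * (\<Sum>n. ennreal ((cmod (fps_nth (a ^ Suc m) n))\<^sup>2 / real ((n + (2 * m + 1)) choose n)))"
proof -
  let ?f = "\<lambda>z. cmod (F z) ^ (2 * Suc m) * Im z ^ (2 * m)"
  let ?d = "\<lambda>w. - 2 * \<i> * exp (- w) / (1 - exp (- w))\<^sup>2"
  let ?h = "\<lambda>\<zeta>. disc_transfer F \<zeta> ^ Suc m"
  let ?k = "\<lambda>w. (cmod (?h (exp (- w))))\<^sup>2 * (exp (- (2 * Re w)) * (1 - exp (- (2 * Re w))) ^ (2 * m))"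
  have opn: "open upper_half_plane"
    unfolding upper_half_plane_def by (rule open_halfspace_Im_gt)
  have contF: "continuous_on upper_half_plane F"
    using F by (rule holomorphic_on_imp_continuous_on)
  have conth: "continuous_on (ball 0 1) ?h"
    by (intro continuous_intros holomorphic_on_imp_continuous_on disc_transfer_holomorphic F)
  have m1: "(\<lambda>z. indicator (strip_map ` half_strip) z * ?f z) \<in> borel_measurable borel"
  proof -
    have "continuous_on (strip_map ` half_strip) ?f"
      unfolding strip_map_image
      by (intro continuous_intros continuous_on_subset[OF contF]) auto
    moreover have "strip_map ` half_strip \<in> sets borel"
      unfolding strip_map_image using opn by (intro sets.Diff) auto
    ultimately show ?thesis
      using borel_measurable_continuous_on_indicator by fastforce
  qed
  have contk: "continuous_on half_strip ?k"
    by (intro continuous_intros continuous_on_compose2[OF conth]) (use half_strip_exp in auto)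
  then have mk: "(\<lambda>w. indicator half_strip w * ?k w) \<in> borel_measurable borel"
    using borel_measurable_continuous_on_indicator[OF half_strip_borel] by fastforce
  have eq: "indicator half_strip w * ((cmod (?d w))\<^sup>2 * ?f (strip_map w)) = 4 * (indicator half_strip w * ?k w)" for w
    using half_plane_integrand_pullback[of w F m] by (cases "w \<in> half_strip") auto
  have m2: "(\<lambda>w. indicator half_strip w * ((cmod (?d w))\<^sup>2 * ?f (strip_map w))) \<in> borel_measurable borel"
    unfolding eq using mk by measurable
  \<comment> \<open>The half-plane and the image of the half-strip differ by the null set \<open>{\<i>}\<close>.\<close>
  have "(\<integral>\<^sup>+z\<in>upper_half_plane. ennreal (?f z) \<partial>lborel) = (\<integral>\<^sup>+z\<in>strip_map ` half_strip. ennreal (?f z) \<partial>lborel)"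
    using AE_lborel_singleton[of \<i>] unfolding strip_map_image
    by (intro nn_integral_cong_AE) (auto simp: indicator_def elim!: eventually_mono)
  also have "\<dots> = (\<integral>\<^sup>+w\<in>half_strip. ennreal ((cmod (?d w))\<^sup>2 * ?f (strip_map w)) \<partial>lborel)"
  proof (rule nn_integral_holomorphic_change_of_variables)
    show "?f z \<ge> 0" for z by simp
  qed (use m1 m2 inj_on_strip_map strip_map_has_field_derivative in auto)
  also have "\<dots> = (\<integral>\<^sup>+w. ennreal 4 * ennreal (indicator half_strip w * ?k w) \<partial>lborel)"
    using half_plane_integrand_pullback[of _ F m]
    by (intro nn_integral_cong) (auto simp: indicator_def ennreal_mult'[symmetric] simp del: ennreal_numeral)
  also have "\<dots> = ennreal 4 * (\<integral>\<^sup>+w. ennreal (indicator half_strip w * ?k w) \<partial>lborel)"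
    using mk by (intro nn_integral_cmult) simp
  also have "(\<integral>\<^sup>+w. ennreal (indicator half_strip w * ?k w) \<partial>lborel) = (\<integral>\<^sup>+w\<in>half_strip. ennreal (?k w) \<partial>lborel)"
    by (intro nn_integral_cong) (auto simp: indicator_def)
  also have "\<dots> = (\<Sum>n. ennreal (pi * (cmod (fps_nth (a ^ Suc m) n))\<^sup>2 * (fact n * fact (2 * m) / fact (n + 2 * m + 1))))"
    by (rule nn_integral_half_strip_power_series[OF fps_power_sums[OF a] conth])
  also have "\<dots> = (\<Sum>n. ennreal (pi / (2 * real m + 1)) * ennreal ((cmod (fps_nth (a ^ Suc m) n))\<^sup>2 / real ((n + (2 * m + 1)) choose n)))"
  proof (rule suminf_cong)
    fix n
    have "real ((n + (2 * m + 1)) choose n) = fact (n + (2 * m + 1)) / (fact n * fact (2 * m + 1))"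
      using binomial_fact[of n "n + (2 * m + 1)"] by simp
    also have "fact (2 * m + 1) = (2 * real m + 1) * fact (2 * m)"
      by simp
    finally have *: "real ((n + (2 * m + 1)) choose n) = fact (n + (2 * m + 1)) / (fact n * ((2 * real m + 1) * fact (2 * m)))" .
    have "x * y / z = 1 / (k * (z / (x * (k * y))))" if "x > 0" "y > 0" "z > 0" "k > 0" for x y z k :: real
      using that by (simp add: field_simps)
    from this[of "fact n" "fact (2 * m)" "fact (n + (2 * m + 1))" "2 * real m + 1"]
    have "fact n * fact (2 * m) / fact (n + 2 * m + 1) = 1 / ((2 * real m + 1) * real ((n + (2 * m + 1)) choose n))"
      unfolding * add.assoc by (simp del: fact_Suc add_Suc_right)
    then show "ennreal (pi * (cmod (fps_nth (a ^ Suc m) n))\<^sup>2 * (fact n * fact (2 * m) / fact (n + 2 * m + 1)))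
      = ennreal (pi / (2 * real m + 1)) * ennreal ((cmod (fps_nth (a ^ Suc m) n))\<^sup>2 / real ((n + (2 * m + 1)) choose n))"
      by (simp add: ennreal_mult'[symmetric])
  qed
  also have "ennreal 4 * \<dots> = ennreal (4 * pi / (2 * real m + 1)) * (\<Sum>n. ennreal ((cmod (fps_nth (a ^ Suc m) n))\<^sup>2 / real ((n + (2 * m + 1)) choose n)))"
  proof -
    have "ennreal 4 * ennreal (pi / (2 * real m + 1)) = ennreal (4 * pi / (2 * real m + 1))"
      by (subst ennreal_mult'[symmetric]) auto
    then show ?thesis by (simp add: mult.assoc[symmetric] del: ennreal_numeral)
  qed
  finally show ?thesis .
qed

text \<open>
  The truncated inequality passes to the limit because every truncation of the right-hand side is
  bounded by the full sum.
\<close>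

lemma suminf_fps_power_weighted_le:
  fixes a :: "complex fps"
  shows "(\<Sum>n. ennreal ((cmod (fps_nth (a ^ Suc m) n))\<^sup>2 / real ((n + (2 * m + 1)) choose n)))
    \<le> (\<Sum>n. ennreal ((cmod (fps_nth a n))\<^sup>2 / (real n + 1))) ^ Suc m"
proof (rule suminf_le_const)
  fix N
  have "(\<Sum>n<N. ennreal ((cmod (fps_nth (a ^ Suc m) n))\<^sup>2 / real ((n + (2 * m + 1)) choose n)))
     = ennreal (\<Sum>n<N. (cmod (fps_nth (a ^ Suc m) n))\<^sup>2 / real ((n + (2 * m + 1)) choose n))"
    by (rule sum_ennreal) simp
  also have "\<dots> \<le> ennreal ((\<Sum>n<N. (cmod (fps_nth a n))\<^sup>2 / (real n + 1)) ^ Suc m)"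
    by (rule ennreal_leI[OF fps_power_weighted_sum_le])
  also have "\<dots> = (\<Sum>n<N. ennreal ((cmod (fps_nth a n))\<^sup>2 / (real n + 1))) ^ Suc m"
    by (subst sum_ennreal) (auto simp: ennreal_power sum_nonneg simp del: power_Suc)
  also have "\<dots> \<le> (\<Sum>n. ennreal ((cmod (fps_nth a n))\<^sup>2 / (real n + 1))) ^ Suc m"
    by (intro power_mono sum_le_suminf) auto
  finally show "(\<Sum>n<N. ennreal ((cmod (fps_nth (a ^ Suc m) n))\<^sup>2 / real ((n + (2 * m + 1)) choose n)))
     \<le> (\<Sum>n. ennreal ((cmod (fps_nth a n))\<^sup>2 / (real n + 1))) ^ Suc m" .
qed simp

theorem theorem1p1:
  fixes s :: nat and F :: "complex \<Rightarrow> complex"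
  assumes "s \<ge> 1" and "F \<in> bergman_space"
  shows "(\<integral>\<^sup>+z\<in>upper_half_plane. ennreal (cmod (F z) ^ (2 * s) * Im z ^ (2 * s - 2)) \<partial>lborel)
    \<le> ennreal (pi powi (1 - int s) / ((2 * real s - 1) * 2 ^ (2 * s - 2))) *
      (\<integral>\<^sup>+z\<in>upper_half_plane. ennreal ((cmod (F z))\<^sup>2) \<partial>lborel) ^ s"
proof -
  obtain m where s: "s = Suc m"
    using assms(1) by (cases s) auto
  have e: "2 * s - 2 = 2 * m" by (simp add: s)
  have F: "F holomorphic_on upper_half_plane"
    using assms(2) by (simp add: bergman_space_def)
  define a where "a = Abs_fps (\<lambda>n. (deriv ^^ n) (disc_transfer F) 0 / fact n)"
  have a: "(\<lambda>n. fps_nth a n * z ^ n) sums disc_transfer F z" if "cmod z < 1" for z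
    using holomorphic_power_series[OF disc_transfer_holomorphic[OF F], of z] that by (simp add: a_def)
  let ?C = "pi powi (1 - int s) / ((2 * real s - 1) * 2 ^ (2 * s - 2))"
  let ?A = "\<Sum>n. ennreal ((cmod (fps_nth a n))\<^sup>2 / (real n + 1))"
  have w0: "real ((n + 1) choose n) = real n + 1" for n
    by simp
  have coeff_sum: "(\<integral>\<^sup>+z\<in>upper_half_plane. ennreal (cmod (F z) ^ (2 * Suc k) * Im z ^ (2 * k)) \<partial>lborel)
    = ennreal (4 * pi / (2 * real k + 1)) * (\<Sum>n. ennreal ((cmod (fps_nth (a ^ Suc k) n))\<^sup>2 / real ((n + (2 * k + 1)) choose n)))" for k
    by (rule half_plane_integral_eq_coeff_sum[OF F]) (rule a)
  \<comment> \<open>The case \<open>s = 1\<close> of the coefficient formula is the Bergman norm.\<close>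
  have norm: "(\<integral>\<^sup>+z\<in>upper_half_plane. ennreal ((cmod (F z))\<^sup>2) \<partial>lborel) = ennreal (4 * pi) * ?A"
    using coeff_sum[of 0] w0 by (simp del: binomial_Suc_n add_Suc_right)
  have "(\<integral>\<^sup>+z\<in>upper_half_plane. ennreal (cmod (F z) ^ (2 * s) * Im z ^ (2 * s - 2)) \<partial>lborel)
     = ennreal (4 * pi / (2 * real m + 1)) * (\<Sum>n. ennreal ((cmod (fps_nth (a ^ Suc m) n))\<^sup>2 / real ((n + (2 * m + 1)) choose n)))"
    unfolding e unfolding s by (rule coeff_sum)
  also have "\<dots> \<le> ennreal (4 * pi / (2 * real m + 1)) * ?A ^ Suc m"
    by (intro mult_left_mono suminf_fps_power_weighted_le) simp
  also have "ennreal (4 * pi / (2 * real m + 1)) = ennreal ?C * ennreal (4 * pi) ^ Suc m"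
  proof -
    have "pi powi (1 - int s) = inverse (pi ^ m)"
      by (simp add: s power_int_minus)
    moreover have "(2::real) ^ (2 * s - 2) = 4 ^ m"
      by (simp add: s power_mult)
    moreover have "2 * real s - 1 = 2 * real m + 1"
      by (simp add: s)
    ultimately have C: "?C = inverse (pi ^ m) / ((2 * real m + 1) * 4 ^ m)"
      by (simp only:)
    have "4 * p / k = inverse x / (k * y) * (4 * p * (y * x))" if "k > 0" "x > 0" "y > 0" for p k x y :: real
      using that by simp
    from this[of "2 * real m + 1" "pi ^ m" "4 ^ m" pi]
    have "4 * pi / (2 * real m + 1) = ?C * (4 * pi) ^ Suc m"
      unfolding C by (simp only: power_mult_distrib power_Suc) (simp add: mult.assoc)
    moreover have "ennreal (4 * pi) ^ Suc m = ennreal ((4 * pi) ^ Suc m)"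
      by (rule ennreal_power) simp
    ultimately show ?thesis
      using ennreal_mult''[of "(4 * pi) ^ Suc m" ?C] by (simp only: zero_le_power pi_ge_zero mult_nonneg_nonneg zero_le_numeral)
  qed
  also have "ennreal ?C * ennreal (4 * pi) ^ Suc m * ?A ^ Suc m = ennreal ?C * (ennreal (4 * pi) * ?A) ^ s"
    by (simp only: power_mult_distrib mult.assoc s)
  finally show ?thesis by (simp only: norm)
qed

end
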